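(* $S(2,3) = \mathbb{N}_0 \setminus \{1,2,3,5\}$.
   Context: Let $t \le k$ and $v$ be positive integers, $V = \{1,\dots,v\}$, and let $V^k$ be the set of ordered $k$-tuples of elements of $V$. For a $t$-subset $I = \{i_1 < \cdots < i_t\}$ of $\{1,\dots,k\}$ and $(u_1,\dots,u_t) \in V^t$, the tuple $(x_1,\dots,x_k) \in V^k$ is said to contain $(u_1,\dots,u_t)_I$ if $x_{i_j} = u_j$ for all $j = 1,\dots,t$. A $t$-$(v,k)$ Latin trade of volume $s$ is a pair $T = (T_1,T_2)$ of disjoint collections (finite multisets, i.e. repeated elements are allowed; disjoint means no tuple occurs in both), each consisting of $s$ elements of $V^k$ counted with multiplicity, such that for each $t$-subset $I \subseteq \{1,\dots,k\}$ and each $(u_1,\dots,u_t) \in V^t$, the number of elements (with multiplicity) of $T_1$ containing $(u_1,\dots,u_t)_I$ equals the number of elements of $T_2$ containing $(u_1,\dots,u_t)_I$. The trade with $T_1 = T_2 = \emptyset$ (volume $0$) is allowed. The spectrum $S(t,k)$ is the set of all integers $s$ for which there exists, for some $v$, a $t$-$(v,k)$ Latin trade of volume $s$. $\mathbb{N}_0$ denotes the nonnegative integers. *)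

theory Defs
  imports Main "HOL-Library.Multiset"
begin

(* Tuples are lists.  Positions follow list indexing, so a t-subset of {1,...,k} is
   represented by a t-subset of {0..<k}; the point set V is {1..v}. *)

definition tuples :: "nat \<Rightarrow> nat \<Rightarrow> nat list set" where
  "tuples v k = {x. length x = k \<and> set x \<subseteq> {1..v}}"

definition contains_at :: "nat list \<Rightarrow> nat set \<Rightarrow> nat list \<Rightarrow> bool" where
  "contains_at x I u \<longleftrightarrow> (\<forall>j < card I. x ! (sorted_list_of_set I ! j) = u ! j)"

definition latin_trade ::
  "nat \<Rightarrow> nat \<Rightarrow> nat \<Rightarrow> nat \<Rightarrow> nat list multiset \<Rightarrow> nat list multiset \<Rightarrow> bool" where
  "latin_trade t v k s T1 T2 \<longleftrightarrow>
     set_mset T1 \<subseteq> tuples v k \<and> set_mset T2 \<subseteq> tuples v k \<and>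
     size T1 = s \<and> size T2 = s \<and>
     set_mset T1 \<inter> set_mset T2 = {} \<and>
     (\<forall>I u. I \<subseteq> {0..<k} \<and> card I = t \<and> u \<in> tuples v t \<longrightarrow>
        size {#x \<in># T1. contains_at x I u#} = size {#x \<in># T2. contains_at x I u#})"

definition trade_spectrum :: "nat \<Rightarrow> nat \<Rightarrow> nat set" where
  "trade_spectrum t k = {s. \<exists>v > 0. \<exists>T1 T2. latin_trade t v k s T1 T2}"

end

(* Slice a 2-(v,3) trade (T1,T2) by the first coordinate.  A nonempty slice is a trade of strength 1,
   so it meets T1 in at least two elements, and at least two slices are nonempty; hence a positive
   volume is at least 4.  In volume 5 there are exactly two slices a and a'; since T1 and T2 are disjoint
   and agree on the last two coordinates, (a,b,c) occurs in T1 as often as (a',b,c) in T2, so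
   the two slices have equal size and the volume is even, a contradiction.
   Conversely, volumes add (move the second trade to new points), and 4, 6, 7, 9 generate
   all the remaining numbers.  The trade of volume 7 is the sum of two trades of volume 4, namely
   (1-2)(1-2)(1-2) and (2-3)(2-3)(2-3) in tensor notation, in which the tuple (2,2,2) cancels. *)

theory Submission
  imports Defs
begin

section \<open>Trades as equalities of projected multisets\<close>

definition proj :: "nat set \<Rightarrow> 'a list \<Rightarrow> 'a list" where
  "proj I x = map ((!) x) (sorted_list_of_set I)"

text \<open>\<open>contains_at\<close> reads only the first \<open>card I\<close> entries of
  \<open>u\<close>; fixing the length of \<open>u\<close> turns it into an equality of
  lists.\<close>

lemma contains_at_iff_proj:
  assumes "length u = card I"
  shows "contains_at x I u \<longleftrightarrow> proj I x = u"
  using assms by (auto simp: contains_at_def proj_def list_eq_iff_nth_eq)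

lemma proj_in_tuples:
  assumes "x \<in> tuples v k" "I \<subseteq> {0..<k}"
  shows "proj I x \<in> tuples v (card I)"
proof -
  have "finite I" using assms(2) finite_subset by blast
  then have "set (proj I x) \<subseteq> set x"
    using assms by (force simp: tuples_def proj_def)
  then show ?thesis
    using assms(1) by (auto simp: tuples_def proj_def)
qed

lemma proj_map:
  assumes "I \<subseteq> {0..<length x}"
  shows "proj I (map f x) = map f (proj I x)"
proof -
  have "finite I" using assms finite_subset by blast
  then show ?thesis using assms by (auto simp: proj_def)
qed

lemma size_filter_proj: "size {#x \<in># M. proj I x = u#} = count (image_mset (proj I) M) u"
  by (induction M) auto

text \<open>The number of tuples containing \<open>u\<close> at \<open>I\<close> is the multiplicity
  of \<open>u\<close> in the image under \<open>proj I\<close>, so the counting condition over all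
  \<open>u\<close> becomes one multiset equality per \<open>I\<close>.\<close>

lemma latin_trade_iff_image_proj:
  "latin_trade t v k s T1 T2 \<longleftrightarrow>
     set_mset T1 \<subseteq> tuples v k \<and> set_mset T2 \<subseteq> tuples v k \<and>
     size T1 = s \<and> size T2 = s \<and> set_mset T1 \<inter> set_mset T2 = {} \<and>
     (\<forall>I. I \<subseteq> {0..<k} \<and> card I = t \<longrightarrow> image_mset (proj I) T1 = image_mset (proj I) T2)"
proof -
  define P where "P I u \<longleftrightarrow>
    size {#x \<in># T1. contains_at x I u#} = size {#x \<in># T2. contains_at x I u#}" for I u
  define Q where "Q I \<longleftrightarrow> image_mset (proj I) T1 = image_mset (proj I) T2" for I
  have "(\<forall>u \<in> tuples v t. P I u) \<longleftrightarrow> Q I" (is "?L \<longleftrightarrow> ?R")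
    if sub: "set_mset T1 \<subseteq> tuples v k" "set_mset T2 \<subseteq> tuples v k"
      and I: "I \<subseteq> {0..<k}" "card I = t" for I
  proof -
    have size_eq: "size {#x \<in># M. contains_at x I u#} = count (image_mset (proj I) M) u"
      if "u \<in> tuples v t" for u M
      using that I by (simp add: contains_at_iff_proj tuples_def size_filter_proj)
    \<comment> \<open>The trade condition only tests \<open>u\<close> in \<open>tuples v t\<close>;
      for every other \<open>u\<close> both multiplicities vanish.\<close>
    have outside: "count (image_mset (proj I) M) u = 0"
      if "set_mset M \<subseteq> tuples v k" "u \<notin> tuples v t" for u M
      using that I proj_in_tuples[of _ v k I] unfolding count_eq_zero_iff by auto
    show ?thesis
    proof
      assume ?L
      show ?R
        unfolding Q_def
      proof (rule multiset_eqI)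
        fix u
        show "count (image_mset (proj I) T1) u = count (image_mset (proj I) T2) u"
          using \<open>?L\<close> outside[OF sub(1)] outside[OF sub(2)]
          by (cases "u \<in> tuples v t") (auto simp: P_def size_eq)
      qed
    qed (simp add: P_def Q_def size_eq)
  qed
  then have "(\<forall>I u. I \<subseteq> {0..<k} \<and> card I = t \<and> u \<in> tuples v t \<longrightarrow> P I u) \<longleftrightarrow>
      (\<forall>I. I \<subseteq> {0..<k} \<and> card I = t \<longrightarrow> Q I)"
    if "set_mset T1 \<subseteq> tuples v k" "set_mset T2 \<subseteq> tuples v k"
    using that by metis
  then show ?thesis
    unfolding latin_trade_def P_def[symmetric] Q_def[symmetric] by argo
qed

section \<open>Additivity of the spectrum\<close>

lemma add_in_trade_spectrum:
  assumes "r \<in> trade_spectrum t k" "s \<in> trade_spectrum t k" "k > 0"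
  shows "r + s \<in> trade_spectrum t k"
proof -
  obtain v A1 A2 where v: "v > 0" and A: "latin_trade t v k r A1 A2"
    using assms(1) by (auto simp: trade_spectrum_def)
  obtain w B1 B2 where B: "latin_trade t w k s B1 B2"
    using assms(2) by (auto simp: trade_spectrum_def)
  define shift where "shift = map ((+) v)"
  have inj: "inj shift" by (simp add: shift_def)
  have disj: "tuples v k \<inter> shift ` tuples w k = {}"
  proof -
    \<comment> \<open>Since \<open>k > 0\<close>, every tuple has a first entry, and this entry
      tells old points from shifted ones.\<close>
    have "hd (shift y) > v" "hd x \<le> v" if "x \<in> tuples v k" "y \<in> tuples w k" for x y
      using that \<open>k > 0\<close> by (cases x; cases y; force simp: tuples_def shift_def)+
    then show ?thesis by fastforce
  qed
  have in_tuples: "tuples v k \<subseteq> tuples (v + w) k" "shift ` tuples w k \<subseteq> tuples (v + w) k"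
    by (force simp: tuples_def shift_def)+
  \<comment> \<open>Projecting commutes with an entrywise renaming of points, so the equalities for
    \<open>B1\<close> and \<open>B2\<close> carry over to their shifted copies.\<close>
  have proj_shift: "image_mset (proj I) (image_mset shift M) = image_mset shift (image_mset (proj I) M)"
    if "set_mset M \<subseteq> tuples w k" "I \<subseteq> {0..<k}" for I M
    using that unfolding image_mset.compositionality
    by (intro image_mset_cong) (auto simp: shift_def tuples_def intro!: proj_map)
  let ?T1 = "A1 + image_mset shift B1" and ?T2 = "A2 + image_mset shift B2"
  have subA: "set_mset A1 \<subseteq> tuples v k" "set_mset A2 \<subseteq> tuples v k"
    and subB: "set_mset B1 \<subseteq> tuples w k" "set_mset B2 \<subseteq> tuples w k"
    and dA: "set_mset A1 \<inter> set_mset A2 = {}" and dB: "set_mset B1 \<inter> set_mset B2 = {}"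
    using A B by (auto simp: latin_trade_iff_image_proj)
  have "set_mset ?T1 \<subseteq> tuples (v + w) k" "set_mset ?T2 \<subseteq> tuples (v + w) k"
    using subA subB in_tuples by (simp_all, blast+)
  moreover have "size ?T1 = r + s" "size ?T2 = r + s"
    using A B by (auto simp: latin_trade_def)
  moreover have "set_mset ?T1 \<inter> set_mset ?T2 = {}"
  proof -
    have "shift ` set_mset B1 \<inter> shift ` set_mset B2 = {}"
      using dB inj by (metis image_Int image_empty)
    moreover have "set_mset A1 \<inter> shift ` set_mset B2 = {}" "shift ` set_mset B1 \<inter> set_mset A2 = {}"
      using disj subA subB by blast+
    ultimately show ?thesis using dA by auto
  qed
  moreover have "image_mset (proj I) ?T1 = image_mset (proj I) ?T2" if "I \<subseteq> {0..<k}" "card I = t" for I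
    using A B that proj_shift[OF subB(1)] proj_shift[OF subB(2)] unfolding latin_trade_iff_image_proj
    by simp
  ultimately have "latin_trade t (v + w) k (r + s) ?T1 ?T2"
    by (simp add: latin_trade_iff_image_proj)
  then show ?thesis
    using v by (auto simp: trade_spectrum_def)
qed

section \<open>The case of strength 2 and three coordinates\<close>

lemma two_subsets_of_three:
  "I \<subseteq> {0..<3} \<and> card I = 2 \<longleftrightarrow> I = {0,1} \<or> I = {0,2} \<or> I = {1,2::nat}"
proof
  assume I: "I \<subseteq> {0..<3} \<and> card I = 2"
  then obtain a b where "I = {a, b}" "a \<noteq> b" by (auto simp: card_2_iff)
  with I have "a \<in> {0,1,2}" "b \<in> {0,1,2}" "a \<noteq> b" "I = {a, b}" by auto
  then show "I = {0,1} \<or> I = {0,2} \<or> I = {1,2}" by auto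
qed auto

lemma latin_trade_2_3_iff:
  "latin_trade 2 v 3 s T1 T2 \<longleftrightarrow>
     set_mset T1 \<subseteq> tuples v 3 \<and> set_mset T2 \<subseteq> tuples v 3 \<and>
     size T1 = s \<and> size T2 = s \<and> set_mset T1 \<inter> set_mset T2 = {} \<and>
     image_mset (\<lambda>x. [x!0, x!1]) T1 = image_mset (\<lambda>x. [x!0, x!1]) T2 \<and>
     image_mset (\<lambda>x. [x!0, x!2]) T1 = image_mset (\<lambda>x. [x!0, x!2]) T2 \<and>
     image_mset (\<lambda>x. [x!1, x!2]) T1 = image_mset (\<lambda>x. [x!1, x!2]) T2"
proof -
  have "proj {0,1} = (\<lambda>x::nat list. [x!0, x!1])" "proj {0,2} = (\<lambda>x::nat list. [x!0, x!2])"
    "proj {1,2} = (\<lambda>x::nat list. [x!1, x!2])"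
    by (auto simp: proj_def fun_eq_iff)
  then show ?thesis
    unfolding latin_trade_iff_image_proj two_subsets_of_three by auto
qed

text \<open>With lists in place of multisets, every premise can be checked by evaluation on a
  concrete trade.\<close>

lemma latin_trade_2_3_listI:
  fixes xs ys :: "nat list list"
  assumes "\<forall>x \<in> set (xs @ ys). length x = 3 \<and> (\<forall>i \<in> set x. 1 \<le> i \<and> i \<le> v)"
    "length xs = s" "length ys = s"
    "set xs \<inter> set ys = {}" "v > 0"
    "mset (map (\<lambda>x. [x!0, x!1]) xs) = mset (map (\<lambda>x. [x!0, x!1]) ys)"
    "mset (map (\<lambda>x. [x!0, x!2]) xs) = mset (map (\<lambda>x. [x!0, x!2]) ys)"
    "mset (map (\<lambda>x. [x!1, x!2]) xs) = mset (map (\<lambda>x. [x!1, x!2]) ys)"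
  shows "s \<in> trade_spectrum 2 3"
proof -
  have sub: "set xs \<subseteq> tuples v 3" "set ys \<subseteq> tuples v 3"
    using assms(1) unfolding tuples_def set_append by force+
  have "latin_trade 2 v 3 s (mset xs) (mset ys)"
    using assms(2-) sub by (simp add: latin_trade_2_3_iff)
  then show ?thesis using assms by (auto simp: trade_spectrum_def)
qed

section \<open>Explicit trades and the volumes they generate\<close>

lemma four_in_spectrum: "4 \<in> trade_spectrum 2 3"
  \<comment> \<open>The tuples over {1,2} are split by the parity of the number of 2s. Changing one
    coordinate flips the parity, so any two prescribed entries extend once on each side.\<close>
  by (rule latin_trade_2_3_listI[where v = 2 and
      xs = "[[1,1,1],[1,2,2],[2,1,2],[2,2,1]]" and
      ys = "[[1,1,2],[1,2,1],[2,1,1],[2,2,2]]"]) code_simp+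

text \<open>Read (a,b,c) as symbol c in row a and column b: \<open>xs\<close> is the 2 by 3 Latin
  rectangle with rows 123 and 231, and \<open>ys\<close> has the two rows exchanged.\<close>

lemma six_in_spectrum: "6 \<in> trade_spectrum 2 3"
  by (rule latin_trade_2_3_listI[where v = 3 and
      xs = "[[1,1,1],[1,2,2],[1,3,3],[2,1,2],[2,2,3],[2,3,1]]" and
      ys = "[[1,1,2],[1,2,3],[1,3,1],[2,1,1],[2,2,2],[2,3,3]]"]) code_simp+

lemma seven_in_spectrum: "7 \<in> trade_spectrum 2 3"
  by (rule latin_trade_2_3_listI[where v = 3 and
      xs = "[[1,1,1],[1,2,2],[2,1,2],[2,2,1],[2,3,3],[3,2,3],[3,3,2]]" and
      ys = "[[1,1,2],[1,2,1],[2,1,1],[2,2,3],[2,3,2],[3,2,2],[3,3,3]]"]) code_simp+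

text \<open>\<open>xs\<close> is the cyclic Latin square of order 3, and \<open>ys\<close> is the
  same square with its symbols permuted cyclically, so the two differ in every cell.\<close>

lemma nine_in_spectrum: "9 \<in> trade_spectrum 2 3"
  by (rule latin_trade_2_3_listI[where v = 3 and
      xs = "[[1,1,1],[1,2,2],[1,3,3],[2,1,2],[2,2,3],[2,3,1],[3,1,3],[3,2,1],[3,3,2]]" and
      ys = "[[1,1,2],[1,2,3],[1,3,1],[2,1,3],[2,2,1],[2,3,2],[3,1,1],[3,2,2],[3,3,3]]"])
    code_simp+

lemma zero_in_spectrum: "0 \<in> trade_spectrum t k"
proof -
  have "latin_trade t 1 k 0 {#} {#}" by (simp add: latin_trade_def)
  then show ?thesis by (auto simp: trade_spectrum_def)
qed

lemma spectrum_contains: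
  assumes "s \<notin> {1, 2, 3, 5}"
  shows "s \<in> trade_spectrum 2 3"
  using assms
proof (induction s rule: less_induct)
  case (less s)
  \<comment> \<open>For s \<ge> 8, subtracting 4 hits an excluded value only when s = 9, which is
    why 9 needs its own trade.\<close>
  consider "s = 0" | "s = 4" | "s = 6" | "s = 7" | "s = 9" | "s \<ge> 8" "s \<noteq> 9"
    using less.prems by fastforce
  then show ?case
  proof cases
    case 6
    then have "s - 4 < s" "s - 4 \<notin> {1, 2, 3, 5}" by auto
    then have "s - 4 + 4 \<in> trade_spectrum 2 3"
      using less.IH add_in_trade_spectrum four_in_spectrum by simp
    then show ?thesis using 6 by simp
  qed (use zero_in_spectrum four_in_spectrum six_in_spectrum seven_in_spectrum nine_in_spectrum in auto)
qed

section \<open>Exclusion of the volumes 1, 2, 3 and 5\<close>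

lemma tuples_3_eqI:
  assumes "x \<in> tuples v 3" "y \<in> tuples v 3" "x!0 = y!0" "x!1 = y!1" "x!2 = y!2"
  shows "x = y"
  using assms by (auto simp: tuples_def list_eq_iff_nth_eq less_Suc_eq numeral_3_eq_3 numeral_2_eq_2)

lemma latin_trade_commute: "latin_trade t v k s T1 T2 \<Longrightarrow> latin_trade t v k s T2 T1"
  by (auto simp: latin_trade_def)

lemma latin_trade_2_3_match:
  assumes T: "latin_trade 2 v 3 s T1 T2" and x: "x \<in># T1"
  shows "\<exists>y \<in># T2. y!0 = x!0 \<and> y!1 = x!1"
    and "\<exists>y \<in># T2. y!0 = x!0 \<and> y!2 = x!2"
    and "\<exists>y \<in># T2. y!1 = x!1 \<and> y!2 = x!2"
proof -
  have match: "\<exists>y \<in># T2. f y = f x" if "image_mset f T1 = image_mset f T2" for f :: "nat list \<Rightarrow> nat list"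
    using that x by (metis imageE image_eqI set_image_mset)
  note T' = T[unfolded latin_trade_2_3_iff]
  show "\<exists>y \<in># T2. y!0 = x!0 \<and> y!1 = x!1"
    using match[of "\<lambda>x. [x!0, x!1]"] T' by simp
  show "\<exists>y \<in># T2. y!0 = x!0 \<and> y!2 = x!2"
    using match[of "\<lambda>x. [x!0, x!2]"] T' by simp
  show "\<exists>y \<in># T2. y!1 = x!1 \<and> y!2 = x!2"
    using match[of "\<lambda>x. [x!1, x!2]"] T' by simp
qed

text \<open>Walk from \<open>x\<close> to a partner \<open>y\<close> in \<open>T2\<close> and back
  to \<open>z\<close> in \<open>T1\<close>, staying in one slice. Disjointness makes
  \<open>y\<close> differ from \<open>x\<close> in the last coordinate, and \<open>z\<close>
  inherits that entry.\<close>

lemma latin_trade_slice_size_ge_2: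
  assumes T: "latin_trade 2 v 3 s T1 T2" and x: "x \<in># T1"
  shows "2 \<le> size {#y \<in># T1. y!0 = x!0#}"
proof -
  note T' = T[unfolded latin_trade_2_3_iff]
  obtain y where y: "y \<in># T2" "y!0 = x!0" "y!1 = x!1"
    using latin_trade_2_3_match(1)[OF T] x by blast
  have "y \<noteq> x" using T' x y by auto
  then have "y!2 \<noteq> x!2" using T' x y tuples_3_eqI by blast
  moreover obtain z where z: "z \<in># T1" "z!0 = y!0" "z!2 = y!2"
    using latin_trade_2_3_match(2)[OF latin_trade_commute[OF T]] y by blast
  ultimately have "x \<noteq> z" by auto
  then have "{#x, z#} \<subseteq># {#y \<in># T1. y!0 = x!0#}"
    using x y z by (simp add: insert_subset_eq_iff in_diff_count)
  then show ?thesis using size_mset_mono by fastforce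
qed

lemma latin_trade_2_slices_even:
  assumes T: "latin_trade 2 v 3 s T1 T2" and "a \<noteq> a'" and rows: "\<And>x. x \<in># T1 \<Longrightarrow> x!0 = a \<or> x!0 = a'"
  shows "even s"
proof -
  note T' = T[unfolded latin_trade_2_3_iff]
  define f :: "nat list \<Rightarrow> nat list" where "f = (\<lambda>x. [x!1, x!2])"
  define slice :: "nat list multiset \<Rightarrow> nat \<Rightarrow> nat list multiset"
    where "slice M i = {#x \<in># M. x!0 = i#}" for M i
  have rows2: "x!0 = a \<or> x!0 = a'" if x: "x \<in># T2" for x
  proof -
    obtain y where "y \<in># T1" "y!0 = x!0"
      using latin_trade_2_3_match(2)[OF latin_trade_commute[OF T]] x by blast
    then show ?thesis using rows by metis
  qed
  \<comment> \<open>Forgetting the second entry of the projected pairs shows that each slice has the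
    same size in \<open>T1\<close> and in \<open>T2\<close>.\<close>
  have "image_mset (\<lambda>u. u!0) (image_mset (\<lambda>x. [x!0, x!1]) T1)
      = image_mset (\<lambda>u. u!0) (image_mset (\<lambda>x. [x!0, x!1]) T2)"
    using T' by simp
  then have heads: "image_mset (\<lambda>x. x!0) T1 = image_mset (\<lambda>x. x!0) T2"
    by (simp add: multiset.map_comp comp_def)
  have "size (slice M i) = count (image_mset (\<lambda>x. x!0) M) i" for M i
    by (induction M) (auto simp: slice_def)
  then have size_eq: "size (slice T1 i) = size (slice T2 i)" for i
    using heads by simp
  have split: "M = slice M a + slice M a'" if "\<And>x. x \<in># M \<Longrightarrow> x!0 = a \<or> x!0 = a'" for M
    using that \<open>a \<noteq> a'\<close> by (induction M) (auto simp: slice_def)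
  \<comment> \<open>Within a fixed slice \<open>f\<close> determines the tuple, so the disjointness
    of \<open>T1\<close> and \<open>T2\<close> survives the projection.\<close>
  have disj: "count (image_mset f (slice T1 i)) u = 0 \<or> count (image_mset f (slice T2 i)) u = 0" for i u
  proof (rule ccontr)
    assume "\<not> ?thesis"
    then obtain x y where "x \<in># slice T1 i" "f x = u" "y \<in># slice T2 i" "f y = u"
      by (auto simp: count_eq_zero_iff)
    then have "x \<in># T1" "y \<in># T2" "x!0 = y!0" "x!1 = y!1" "x!2 = y!2"
      by (auto simp: slice_def f_def)
    moreover from this have "x = y" using T' tuples_3_eqI by blast
    ultimately show False using T' by auto
  qed
  have "image_mset f T1 = image_mset f T2"
    using T' by (simp add: f_def)
  then have "image_mset f (slice T1 a) + image_mset f (slice T1 a')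
    = image_mset f (slice T2 a) + image_mset f (slice T2 a')"
    using split[OF rows] split[OF rows2] by (metis image_mset_union)
  then have sum: "count (image_mset f (slice T1 a)) u + count (image_mset f (slice T1 a')) u
    = count (image_mset f (slice T2 a)) u + count (image_mset f (slice T2 a')) u" for u
    by (metis count_union)
  \<comment> \<open>From p + q = r + w, with p or r zero and q or w zero, it follows that p = w: the
    slices match crosswise.\<close>
  have "image_mset f (slice T1 a) = image_mset f (slice T2 a')"
  proof (rule multiset_eqI)
    fix u
    show "count (image_mset f (slice T1 a)) u = count (image_mset f (slice T2 a')) u"
      using sum[of u] disj[of a u] disj[of a' u] by linarith
  qed
  then have "size (slice T1 a) = size (slice T2 a')"
    by (metis size_image_mset)
  then have "size (slice T1 a) = size (slice T1 a')"
    using size_eq by simp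
  moreover have "s = size (slice T1 a) + size (slice T1 a')"
    using T' split[OF rows] by (metis size_union)
  ultimately show ?thesis by simp
qed

lemma spectrum_excludes:
  assumes "s \<in> trade_spectrum 2 3"
  shows "s \<notin> {1, 2, 3, 5}"
proof -
  obtain v T1 T2 where T: "latin_trade 2 v 3 s T1 T2"
    using assms by (auto simp: trade_spectrum_def)
  note T' = T[unfolded latin_trade_2_3_iff]
  show ?thesis
  proof (cases "s = 0")
    case False
    then obtain x where x: "x \<in># T1" using T' by fastforce
    \<comment> \<open>A partner agreeing with \<open>x\<close> in the last two coordinates must
      differ in the first; going back to \<open>T1\<close> from it yields a second nonempty
      slice.\<close>
    obtain w where w: "w \<in># T2" "w!1 = x!1" "w!2 = x!2"
      using latin_trade_2_3_match(3)[OF T] x by blast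
    have "w \<noteq> x" using T' x w by auto
    then have "w!0 \<noteq> x!0" using T' x w tuples_3_eqI by blast
    moreover obtain y where y: "y \<in># T1" "y!0 = w!0"
      using latin_trade_2_3_match(1)[OF latin_trade_commute[OF T]] w by blast
    ultimately have neq: "x!0 \<noteq> y!0" by simp
    let ?A = "{#z \<in># T1. z!0 = x!0#}" and ?B = "{#z \<in># T1. z!0 = y!0#}"
    let ?C = "{#z \<in># T1. z!0 \<noteq> x!0 \<and> z!0 \<noteq> y!0#}"
    have "T1 = ?A + ?B + ?C"
      using neq by (induction T1) auto
    then have s: "s = size ?A + size ?B + size ?C"
      using T' by (metis size_union)
    have ge: "size ?A \<ge> 2" "size ?B \<ge> 2"
      using latin_trade_slice_size_ge_2[OF T x] latin_trade_slice_size_ge_2[OF T y(1)] by blast+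
    have "s \<noteq> 5"
    proof
      assume "s = 5"
      \<comment> \<open>A third slice would lie in \<open>?C\<close>, which has at most 5 - 2 - 2 =
        1 element, whereas a nonempty slice has at least 2.\<close>
      have "z!0 = x!0 \<or> z!0 = y!0" if z: "z \<in># T1" for z
      proof (rule ccontr)
        assume "\<not> ?thesis"
        then have "{#u \<in># T1. u!0 = z!0#} \<subseteq># ?C"
          by (auto intro!: mset_subset_eqI)
        then have "size {#u \<in># T1. u!0 = z!0#} \<le> size ?C"
          by (rule size_mset_mono)
        then show False
          using latin_trade_slice_size_ge_2[OF T z] s ge \<open>s = 5\<close> by linarith
      qed
      then have "even s" using latin_trade_2_slices_even[OF T neq] by blast
      then show False using \<open>s = 5\<close> by simp
    qed
    moreover have "s \<ge> 4" using s ge by linarith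
    ultimately show ?thesis by auto
  qed simp
qed

theorem proposition3:
  shows "trade_spectrum 2 3 = UNIV - {1, 2, 3, 5}"
  using spectrum_contains spectrum_excludes by blast

end
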